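(* Let $a$ be a positive integer, and let $p, q, r$ and $P, Q, R$ be integers such that $$pr - q^2 = a, \quad |2q| \le |p|, \quad |2q| \le |r|, \qquad PR - Q^2 = a, \quad |2Q| \le |P|, \quad |2Q| \le |R|.$$ If the form $py^2 + 2qyz + rz^2$ can be transformed into the form $Ps^2 + 2Qsx + Rx^2$ by a substitution $y = Ms + Nx$, $z = ms + nx$ with integers $M, N, m, n$, then the two forms are the same up to exchanging the two outer coefficients and changing the sign of the middle one; that is, $|Q| = |q|$ and either $(P,R) = (p,r)$ or $(P,R) = (r,p)$. *)

theory Defs
  imports Main
begin

definition quad_form :: "int \<Rightarrow> int \<Rightarrow> int \<Rightarrow> int \<Rightarrow> int \<Rightarrow> int" where
  "quad_form p q r y z = p * y\<^sup>2 + 2 * q * y * z + r * z\<^sup>2"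

(* The identity of the two forms after substitution is required for all integer values of
   s and x; over the integers this is the same as equality of the coefficients. No condition
   is imposed on the determinant of the substitution. *)
definition transformable :: "int \<times> int \<times> int \<Rightarrow> int \<times> int \<times> int \<Rightarrow> bool" where
  "transformable = (\<lambda>(p, q, r) (P, Q, R).
     \<exists>M N m n :: int. \<forall>s x :: int.
       quad_form p q r (M * s + N * x) (m * s + n * x) = quad_form P Q R s x)"

end

theory Submission
  imports Defs
begin

text \<open>
  Changing the sign of both forms, and exchanging outer coefficients, reduces the claim to forms
  with \<open>0 < p \<le> r\<close> and \<open>0 < P \<le> R\<close>. For such a reduced form, \<open>p\<close> and \<open>r\<close> are the two successive
  minima: every value at a point off the first axis is at least \<open>r\<close>
  (\<open>reduced_form_lower_bound\<close>), and the values at nonzero points of that axis are at least \<open>p\<close>.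
  The columns \<open>(M, m)\<close> and \<open>(N, n)\<close> of an invertible substitution are linearly independent, and \<open>P\<close>
  and \<open>R\<close> are the values of the first form there; hence \<open>p \<le> P\<close> and \<open>r \<le> R\<close>
  (\<open>reduced_coefficients_le\<close>).

  A substitution multiplies \<open>p r - q\<^sup>2\<close> by the square of its determinant. Since both forms have the
  same \<open>p r - q\<^sup>2 = a \<noteq> 0\<close>, the determinant is a unit, so the substitution can be inverted over the
  integers (\<open>transformable_sym\<close>), and the same comparison in the other direction yields \<open>P = p\<close> and
  \<open>R = r\<close>. Finally \<open>Q\<^sup>2 = P R - a = p r - a = q\<^sup>2\<close>.
\<close>

lemma transformable_iff_coefficients:
  "transformable (p, q, r) (P, Q, R) \<longleftrightarrow>
    (\<exists>M N m n. P = quad_form p q r M m \<and> R = quad_form p q r N n \<and>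
               Q = p * M * N + q * (M * n + N * m) + r * m * n)"
  (is "?L \<longleftrightarrow> ?R")
proof
  assume ?L
  then obtain M N m n where
    eq: "\<And>s x. quad_form p q r (M * s + N * x) (m * s + n * x) = quad_form P Q R s x"
    unfolding transformable_def by auto
  have P: "P = quad_form p q r M m"
    using eq[of 1 0] by (simp add: quad_form_def)
  have R: "R = quad_form p q r N n"
    using eq[of 0 1] by (simp add: quad_form_def)
  have "2 * Q = quad_form p q r (M + N) (m + n) - P - R"
    using eq[of 1 1] by (simp add: quad_form_def)
  also have "\<dots> = 2 * (p * M * N + q * (M * n + N * m) + r * m * n)"
    unfolding P R by (simp add: quad_form_def power2_eq_square algebra_simps)
  finally have "Q = p * M * N + q * (M * n + N * m) + r * m * n"
    by simp
  with P R show ?R by blast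
next
  assume ?R
  then obtain M N m n where
    "P = quad_form p q r M m" "R = quad_form p q r N n"
    "Q = p * M * N + q * (M * n + N * m) + r * m * n"
    by blast
  then have "quad_form p q r (M * s + N * x) (m * s + n * x) = quad_form P Q R s x" for s x
    by (simp add: quad_form_def power2_eq_square algebra_simps)
  then show ?L unfolding transformable_def by auto
qed

lemma determinant_of_transform:
  "quad_form p q r M m * quad_form p q r N n - (p * M * N + q * (M * n + N * m) + r * m * n)\<^sup>2
    = (M * n - N * m)\<^sup>2 * (p * r - q\<^sup>2)"
  by (simp add: quad_form_def power2_eq_square algebra_simps)

lemma transformable_swap_source:
  "transformable (p, q, r) (P, Q, R) \<Longrightarrow> transformable (r, q, p) (P, Q, R)"
  unfolding transformable_iff_coefficients
proof (elim exE conjE)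
  fix M N m n
  assume "P = quad_form p q r M m" "R = quad_form p q r N n"
    "Q = p * M * N + q * (M * n + N * m) + r * m * n"
  then show "\<exists>M N m n. P = quad_form r q p M m \<and> R = quad_form r q p N n \<and>
               Q = r * M * N + q * (M * n + N * m) + p * m * n"
    by (intro exI[of _ m] exI[of _ n] exI[of _ M] exI[of _ N])
      (simp add: quad_form_def algebra_simps)
qed

lemma transformable_swap_target:
  "transformable (p, q, r) (P, Q, R) \<Longrightarrow> transformable (p, q, r) (R, Q, P)"
  unfolding transformable_iff_coefficients
proof (elim exE conjE)
  fix M N m n
  assume "P = quad_form p q r M m" "R = quad_form p q r N n"
    "Q = p * M * N + q * (M * n + N * m) + r * m * n"
  then show "\<exists>M N m n. R = quad_form p q r M m \<and> P = quad_form p q r N n \<and>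
               Q = p * M * N + q * (M * n + N * m) + r * m * n"
    by (intro exI[of _ N] exI[of _ M] exI[of _ n] exI[of _ m]) (simp add: algebra_simps)
qed

lemma transformable_uminus:
  assumes "transformable (p, q, r) (P, Q, R)"
  shows "transformable (- p, - q, - r) (- P, - Q, - R)"
proof -
  have "quad_form (- u) (- v) (- w) y z = - quad_form u v w y z" for u v w y z
    by (simp add: quad_form_def)
  then show ?thesis using assms by (simp add: transformable_def)
qed

text \<open>Equal nonzero \<open>p r - q\<^sup>2\<close> forces the determinant of the substitution to be a unit \<open>d\<close> with
  \<open>d\<^sup>2 = 1\<close>, so the inverse matrix, \<open>d\<close> times the adjugate, is integral.\<close>

lemma transformable_sym:
  assumes "transformable (p, q, r) (P, Q, R)"
    and disc: "P * R - Q\<^sup>2 = p * r - q\<^sup>2" "p * r - q\<^sup>2 \<noteq> 0"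
  shows "transformable (P, Q, R) (p, q, r)"
proof -
  obtain M N m n where
    eq: "\<And>s x. quad_form p q r (M * s + N * x) (m * s + n * x) = quad_form P Q R s x"
    and d: "(M * n - N * m)\<^sup>2 * (p * r - q\<^sup>2) = p * r - q\<^sup>2"
  proof -
    obtain M N m n where
      c: "P = quad_form p q r M m" "R = quad_form p q r N n"
         "Q = p * M * N + q * (M * n + N * m) + r * m * n"
      using assms(1) unfolding transformable_iff_coefficients by blast
    have "quad_form p q r (M * s + N * x) (m * s + n * x) = quad_form P Q R s x" for s x
      unfolding c by (simp add: quad_form_def power2_eq_square algebra_simps)
    moreover have "(M * n - N * m)\<^sup>2 * (p * r - q\<^sup>2) = p * r - q\<^sup>2"
      using disc(1) determinant_of_transform[of p q r M m N n] unfolding c by argo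
    ultimately show thesis using that by blast
  qed
  define d where "d = M * n - N * m"
  have dd: "d * d = 1"
    using d disc(2) by (simp add: d_def power2_eq_square)
  have "quad_form P Q R (d * n * s + (- d * N) * x) ((- d * m) * s + d * M * x)
      = quad_form p q r s x" for s x
  proof -
    have "M * (d * n * s + (- d * N) * x) + N * ((- d * m) * s + d * M * x) = d * d * s"
      by (simp add: d_def algebra_simps)
    moreover have "m * (d * n * s + (- d * N) * x) + n * ((- d * m) * s + d * M * x) = d * d * x"
      by (simp add: d_def algebra_simps)
    ultimately show ?thesis
      using eq[of "d * n * s + (- d * N) * x" "(- d * m) * s + d * M * x"] dd by simp
  qed
  then show ?thesis
    unfolding transformable_def by blast
qed

text \<open>Since \<open>\<bar>2 q\<bar> \<le> p\<close>, the value is at least \<open>p \<bar>y\<bar> (\<bar>y\<bar> - \<bar>z\<bar>) + r z\<^sup>2\<close>. For \<open>\<bar>y\<bar> \<ge> \<bar>z\<bar>\<close> the first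
  summand is nonnegative; for \<open>\<bar>y\<bar> < \<bar>z\<bar>\<close> it is at least \<open>- p (z\<^sup>2 - 1)\<close>, because
  \<open>\<bar>y\<bar> \<le> \<bar>z\<bar> - 1\<close> and \<open>\<bar>z\<bar> - \<bar>y\<bar> \<le> \<bar>z\<bar>\<close>, and \<open>p \<le> r\<close> leaves at least \<open>r\<close>.\<close>

lemma reduced_form_lower_bound:
  assumes "0 < p" "p \<le> r" "\<bar>2 * q\<bar> \<le> p" "z \<noteq> 0"
  shows "r \<le> quad_form p q r y z"
proof -
  define u v where "u = \<bar>y\<bar>" and "v = \<bar>z\<bar>"
  have uv: "0 \<le> u" "1 \<le> v" using assms(4) by (auto simp: u_def v_def)
  have "\<bar>2 * q * y * z\<bar> = \<bar>2 * q\<bar> * (u * v)"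
    by (simp add: u_def v_def abs_mult)
  also have "\<dots> \<le> p * (u * v)"
    using assms(3) uv by (intro mult_right_mono) auto
  finally have cross: "- (p * (u * v)) \<le> 2 * q * y * z" by linarith
  have "y\<^sup>2 = u * u" "z\<^sup>2 = v * v"
    by (simp_all add: u_def v_def power2_eq_square)
  then have val: "p * (u * u) - p * (u * v) + r * (v * v) \<le> quad_form p q r y z"
    using cross by (simp add: quad_form_def)
  have vv: "1 \<le> v * v" using mult_mono[of 1 v 1 v] uv by simp
  have "r \<le> p * (u * u) - p * (u * v) + r * (v * v)"
  proof (cases "v \<le> u")
    case True
    then have "p * (u * v) \<le> p * (u * u)"
      using assms(1) uv by (simp add: mult_left_mono)
    moreover have "r * 1 \<le> r * (v * v)"
      using vv assms by (intro mult_left_mono) auto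
    ultimately show ?thesis by simp
  next
    case False
    have "u * (v - u) \<le> (v - 1) * v"
      using False uv by (intro mult_mono) auto
    also have "\<dots> \<le> v * v - 1"
      using uv by (simp add: algebra_simps)
    finally have "p * (u * (v - u)) \<le> p * (v * v - 1)"
      using assms(1) by (simp add: mult_left_mono)
    also have "\<dots> \<le> r * (v * v - 1)"
      using assms(2) vv by (simp add: mult_right_mono)
    finally show ?thesis by (simp add: algebra_simps)
  qed
  with val show ?thesis by linarith
qed

text \<open>Minimality of the successive minima. A nondegenerate target means that the
  columns of the substitution are independent. If the column \<open>(N, n)\<close> lies on the first axis, then \<open>(M, m)\<close>
  does not, and \<open>R \<ge> P \<ge> r\<close>.\<close>

lemma reduced_coefficients_le:
  assumes red: "0 < p" "p \<le> r" "\<bar>2 * q\<bar> \<le> p"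
    and "transformable (p, q, r) (P, Q, R)" "P * R - Q\<^sup>2 \<noteq> 0" "P \<le> R"
  shows "p \<le> P" "r \<le> R"
proof -
  obtain M N m n where
    c: "P = quad_form p q r M m" "R = quad_form p q r N n"
       "Q = p * M * N + q * (M * n + N * m) + r * m * n"
    using assms(4) unfolding transformable_iff_coefficients by blast
  have det: "M * n - N * m \<noteq> 0"
    using assms(5) unfolding c determinant_of_transform by auto
  have m: "r \<le> P" if "m \<noteq> 0"
    unfolding c using reduced_form_lower_bound[OF red that] .
  have n: "r \<le> R" if "n \<noteq> 0"
    unfolding c using reduced_form_lower_bound[OF red that] .
  show "r \<le> R"
    using m n det \<open>P \<le> R\<close> by (cases "n = 0") auto
  show "p \<le> P"
  proof (cases "m = 0")
    case True
    with det have "0 < M\<^sup>2" by auto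
    then have "1 \<le> M\<^sup>2" by linarith
    then have "p * 1 \<le> p * M\<^sup>2"
      using red(1) by (intro mult_left_mono) auto
    with True show ?thesis by (simp add: c quad_form_def)
  next
    case False
    with m red show ?thesis by linarith
  qed
qed

lemma ordered_reduced_forms_eq:
  assumes "0 < p" "p \<le> r" "\<bar>2 * q\<bar> \<le> p" "0 < P" "P \<le> R" "\<bar>2 * Q\<bar> \<le> P"
    and "transformable (p, q, r) (P, Q, R)"
    and "P * R - Q\<^sup>2 = p * r - q\<^sup>2" "p * r - q\<^sup>2 \<noteq> 0"
  shows "P = p \<and> R = r"
  using reduced_coefficients_le[of p r q P Q R] reduced_coefficients_le[of P R Q p q r]
    transformable_sym[of p q r P Q R] assms by fastforce

lemma positive_reduced_forms_eq:
  assumes "0 < p" "0 < r" "\<bar>2 * q\<bar> \<le> p" "\<bar>2 * q\<bar> \<le> r"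
    and "0 < P" "0 < R" "\<bar>2 * Q\<bar> \<le> P" "\<bar>2 * Q\<bar> \<le> R"
    and t: "transformable (p, q, r) (P, Q, R)"
    and "P * R - Q\<^sup>2 = p * r - q\<^sup>2" "p * r - q\<^sup>2 \<noteq> 0"
  shows "P = p \<and> R = r \<or> P = r \<and> R = p"
proof -
  note comm = mult.commute[of r p] mult.commute[of R P]
  consider "p \<le> r" "P \<le> R" | "p \<le> r" "R \<le> P" | "r \<le> p" "P \<le> R" | "r \<le> p" "R \<le> P"
    by linarith
  then show ?thesis
  proof cases
    case 1
    then show ?thesis
      using ordered_reduced_forms_eq[of p r q P R Q] assms by simp
  next
    case 2
    then show ?thesis
      using ordered_reduced_forms_eq[of p r q R P Q] transformable_swap_target[OF t] assms comm
      by simp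
  next
    case 3
    then show ?thesis
      using ordered_reduced_forms_eq[of r p q P R Q] transformable_swap_source[OF t] assms comm
      by simp
  next
    case 4
    then show ?thesis
      using ordered_reduced_forms_eq[of r p q R P Q]
        transformable_swap_source[OF transformable_swap_target[OF t]] assms comm
      by simp
  qed
qed

text \<open>Completing the square, \<open>p P = (p M + q m)\<^sup>2 + (p r - q\<^sup>2) m\<^sup>2\<close>, so the sign of
  \<open>P\<close> cannot be opposite to that of \<open>p\<close>.\<close>

lemma definite_same_sign:
  assumes "transformable (p, q, r) (P, Q, R)" "p * r - q\<^sup>2 > 0"
  shows "0 \<le> p * P"
proof -
  obtain M m where P: "P = quad_form p q r M m"
    using assms(1) unfolding transformable_iff_coefficients by blast
  have "p * P = (p * M + q * m)\<^sup>2 + (p * r - q\<^sup>2) * m\<^sup>2"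
    unfolding P by (simp add: quad_form_def power2_eq_square algebra_simps)
  with assms(2) show ?thesis by simp
qed

theorem mainTheorem10:
  fixes a p q r P Q R :: int
  assumes "a > 0"
    and "p * r - q\<^sup>2 = a" and "\<bar>2 * q\<bar> \<le> \<bar>p\<bar>" and "\<bar>2 * q\<bar> \<le> \<bar>r\<bar>"
    and "P * R - Q\<^sup>2 = a" and "\<bar>2 * Q\<bar> \<le> \<bar>P\<bar>" and "\<bar>2 * Q\<bar> \<le> \<bar>R\<bar>"
    and "transformable (p, q, r) (P, Q, R)"
  shows "\<bar>Q\<bar> = \<bar>q\<bar> \<and> ((P, R) = (p, r) \<or> (P, R) = (r, p))"
proof -
  have pr: "0 < p * r" and PR: "0 < P * R"
    using assms(1,2,5) zero_le_power2[of q] zero_le_power2[of Q] by linarith+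
  have pP: "0 \<le> p * P"
    using definite_same_sign assms by blast
  have outer: "P = p \<and> R = r \<or> P = r \<and> R = p"
  proof (cases "0 < p")
    case True
    with pr PR pP have "0 < r" "0 < P" "0 < R"
      by (auto simp: zero_less_mult_iff zero_le_mult_iff)
    with True show ?thesis
      using positive_reduced_forms_eq[of p r q P R Q] assms by simp
  next
    case False
    with pr PR pP have "p < 0" "r < 0" "P < 0" "R < 0"
      by (auto simp: zero_less_mult_iff zero_le_mult_iff)
    then show ?thesis
      using positive_reduced_forms_eq[of "- p" "- r" "- q" "- P" "- R" "- Q"]
        transformable_uminus[OF assms(8)] assms by simp
  qed
  then have "P * R = p * r" by auto
  then have "Q\<^sup>2 = q\<^sup>2" using assms(2,5) by linarith
  then have "\<bar>Q\<bar> = \<bar>q\<bar>" by (simp add: power2_eq_iff abs_eq_iff)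
  with outer show ?thesis by auto
qed

end
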